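(* There exists a system $\mathcal S=\{S_1,S_2,S_3,S_h\}$ of four contraction similarities of $\mathbb R^2$ with attractor $K$ such that: (i) $K$ is a dendrite; (ii) $\mathcal S$ satisfies the open set condition; (iii) $\mathcal S$ satisfies the one point intersection property; (iv) the post-critical set $\mathcal P$ of $\mathcal S$ is infinite, and its projection $\pi(\mathcal P)\subset K$ is dense in the middle-third Cantor set $\mathcal C\times\{0\}\subset[0,1]\times\{0\}\subset\mathbb R^2$.
   Context: Let $\mathcal S=\{S_i\}_{i\in J}$ be a finite system of contraction maps of $\mathbb R^2$ with index set $J$ (here $J=\{1,2,3,h\}$, where $h$ is used as a symbol). The attractor of $\mathcal S$ is the unique non-empty compact set $K$ with $K=\bigcup_{i\in J}S_i(K)$. The address map $\pi:J^\infty\to K$ sends $\alpha=\alpha_1\alpha_2\ldots$ to the unique point of $\bigcap_{n\ge1}S_{\alpha_1}\circ\cdots\circ S_{\alpha_n}(K)$. Open set condition (OSC): there is a non-empty open set $O\subset\mathbb R^2$ with $S_i(O)\subset O$ for all $i\in J$ and $S_i(O)\cap S_j(O)=\varnothing$ for all $i\ne j$ in $J$. One point intersection property: $\#(S_i(K)\cap S_j(K))\le 1$ for all $i\neq j$ in $J$. Post-critical set: let $E=\bigcup_{i\ne j}\big(S_i(K)\cap S_j(K)\big)$. The post-critical set is $\mathcal P=\{\sigma^k(\alpha): \alpha\in J^\infty,\ \pi(\alpha)\in E,\ k\ge 1\}\subset J^\infty$, where $\sigma^k(\alpha_1\alpha_2\ldots)=\alpha_{k+1}\alpha_{k+2}\ldots$.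 Equivalently, $\mathcal P$ is the set of $\alpha\in J^\infty$ such that $S_{j_1}\circ\cdots\circ S_{j_n}(\pi(\alpha))\in E$ for some $n\ge1$ and some $j_1,\ldots,j_n\in J$ (using $\pi(j_1\ldots j_n\alpha)=S_{j_1}\circ\cdots\circ S_{j_n}(\pi(\alpha))$). $\mathcal C\subset[0,1]$ is the middle-third Cantor set. A set $A\subset\mathbb R^2$ is called dense in $\mathcal C\times\{0\}$ if $\mathcal C\times\{0\}\subset\overline A$ (it is not required that $A\subset \mathcal C\times\{0\}$). A dendrite is a locally connected continuum (non-empty compact connected metrizable space) that contains no simple closed curve. *)

theory Defs
  imports "HOL-Analysis.Analysis" "HOL-Library.Stream"
begin

definition contraction_similarity :: "('a::metric_space \<Rightarrow> 'a) \<Rightarrow> bool" where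
  "contraction_similarity f \<longleftrightarrow> (\<exists>r. 0 < r \<and> r < 1 \<and> (\<forall>x y. dist (f x) (f y) = r * dist x y))"

text \<open>
  A system of maps is a family indexed by a type \<open>'i\<close>. For a finite system of contractions
  of a non-empty complete space exactly one set satisfies the following predicate.
\<close>

definition is_attractor :: "('i \<Rightarrow> 'a::topological_space \<Rightarrow> 'a) \<Rightarrow> 'a set \<Rightarrow> bool" where
  "is_attractor S K \<longleftrightarrow> K \<noteq> {} \<and> compact K \<and> K = (\<Union>i. S i ` K)"

definition word_map :: "('i \<Rightarrow> 'a \<Rightarrow> 'a) \<Rightarrow> 'i list \<Rightarrow> 'a \<Rightarrow> 'a" where
  "word_map S w = foldr (\<lambda>i f. S i \<circ> f) w id"

definition address_map :: "('i \<Rightarrow> 'a \<Rightarrow> 'a) \<Rightarrow> 'a set \<Rightarrow> 'i stream \<Rightarrow> 'a" where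
  "address_map S K \<alpha> = (THE x. x \<in> (\<Inter>n\<in>{1..}. word_map S (stake n \<alpha>) ` K))"

definition open_set_condition :: "('i \<Rightarrow> 'a::topological_space \<Rightarrow> 'a) \<Rightarrow> bool" where
  "open_set_condition S \<longleftrightarrow>
     (\<exists>U. open U \<and> U \<noteq> {} \<and> (\<forall>i. S i ` U \<subseteq> U) \<and> (\<forall>i j. i \<noteq> j \<longrightarrow> S i ` U \<inter> S j ` U = {}))"

definition one_point_intersection :: "('i \<Rightarrow> 'a \<Rightarrow> 'a) \<Rightarrow> 'a set \<Rightarrow> bool" where
  "one_point_intersection S K \<longleftrightarrow>
     (\<forall>i j. i \<noteq> j \<longrightarrow> finite (S i ` K \<inter> S j ` K) \<and> card (S i ` K \<inter> S j ` K) \<le> 1)"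

definition overlap_set :: "('i \<Rightarrow> 'a \<Rightarrow> 'a) \<Rightarrow> 'a set \<Rightarrow> 'a set" where
  "overlap_set S K = (\<Union>i. \<Union>j\<in>-{i}. S i ` K \<inter> S j ` K)"

definition post_critical_set :: "('i \<Rightarrow> 'a \<Rightarrow> 'a) \<Rightarrow> 'a set \<Rightarrow> 'i stream set" where
  "post_critical_set S K = {sdrop k \<alpha> | k \<alpha>. address_map S K \<alpha> \<in> overlap_set S K \<and> 1 \<le> k}"

fun cantor_stage :: "nat \<Rightarrow> real set" where
  "cantor_stage 0 = {0..1}"
| "cantor_stage (Suc n) =
     (\<lambda>x. x / 3) ` cantor_stage n \<union> (\<lambda>x. (x + 2) / 3) ` cantor_stage n"

definition cantor_set :: "real set" where
  "cantor_set = (\<Inter>n. cantor_stage n)"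

text \<open>
  A simple closed curve is the image of a simple path whose endpoints coincide.
\<close>

definition dendrite :: "'a::metric_space set \<Rightarrow> bool" where
  "dendrite K \<longleftrightarrow> K \<noteq> {} \<and> compact K \<and> connected K \<and> locally connected K \<and>
     \<not> (\<exists>g. simple_path g \<and> pathstart g = pathfinish g \<and> path_image g \<subseteq> K)"

datatype index = I1 | I2 | I3 | Ih

end

theory Submission
  imports Defs
begin

text \<open>
  Three of the maps, \<open>z \<mapsto> (z + d) / 3\<close> with \<open>d = 0, 1, 2\<close>, have the unit segment as their
  attractor. The fourth map plants a small copy of the whole picture, turned by a right angle, on a
  point \<open>(c, 0)\<close> of the segment. The attractor is the segment with hairs, hairs on hairs, and so
  on. Since the hair meets the middle third exactly in its root \<open>(c, 0)\<close>, all shifts of the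
  ternary code of \<open>c\<close> are post-critical, so their values should be dense in the Cantor set.

  The number \<open>c\<close> is where the two demands collide. The hairs attached by words in the three
  segment maps have roots \<open>(c + k) / 3 ^ n\<close>, and they stay away from the hair at \<open>c\<close> only if the
  shifted expansions \<open>3 ^ n * c - k\<close> stay away from \<open>c\<close>. A number with a dense orbit in the
  Cantor set that itself belongs to the Cantor set would be recurrent. Therefore \<open>c\<close> gets the
  code 1 0 2 followed by a sequence over the digits 0 and 2 that contains every finite word: the
  leading digit 1 keeps \<open>c\<close> at distance at least 2/27 from the Cantor set, in which all its proper
  shifts lie (\<open>root_nonrecurrent\<close>).

  All the pieces lie in images of a diamond with diagonal the unit segment. The diamond
  of a hair is thin near its root, which scales with the size of the neighbouring hairs; this and
  the nonrecurrence separate the diamonds of any two hairs of the form above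
  (\<open>triadic_image_of_hair_disjoint\<close>). Thus a common point of the hair and the middle piece lies in
  ever smaller images of the diamond under segment maps, so it is on the axis
  (\<open>middle_piece_meets_hair\<close>). For these two pieces, which are the delicate pair, this one argument gives
  both the one point intersection property and the open set condition; the open set for the latter
  consists of all images of the lower half of the diamond.

  The attractor is connected since every piece meets the segment, and locally connected since it
  is a finite union of arbitrarily small connected pieces. The four first level pieces form a tree
  whose edges are single common points, so a simple loop must lie in one piece
  (\<open>simple_loop_in_piece\<close>). Blowing that piece up gives a simple loop in the attractor
  that is at least three times as large. Repeating this contradicts boundedness.
\<close>

section \<open>Simple loops and local connectedness in unions of pieces\<close>

text \<open>
  The pieces that contain a given point form a connected set, and removing the finitely many other
  closed pieces leaves a neighbourhood of that point inside their union.
\<close>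

lemma locally_connected_if_small_connected_covers:
  fixes K :: "'a::metric_space set"
  assumes "\<And>e. e > 0 \<Longrightarrow> \<exists>\<F>. finite \<F> \<and> \<Union>\<F> = K \<and>
    (\<forall>C\<in>\<F>. closed C \<and> connected C \<and> (\<forall>x\<in>C. \<forall>y\<in>C. dist x y < e))"
  shows "locally connected K"
  unfolding locally_connected_im_kleinen
proof (intro allI impI, elim conjE)
  fix v x assume v: "openin (top_of_set K) v" and x: "x \<in> v"
  obtain e where e: "e > 0" "\<And>y. y \<in> K \<Longrightarrow> dist y x < e \<Longrightarrow> y \<in> v"
    using v x unfolding openin_euclidean_subtopology_iff by blast
  obtain \<F> where F: "finite \<F>" "\<Union>\<F> = K" "\<And>C. C \<in> \<F> \<Longrightarrow> closed C" "\<And>C. C \<in> \<F> \<Longrightarrow> connected C"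
      "\<And>C a b. C \<in> \<F> \<Longrightarrow> a \<in> C \<Longrightarrow> b \<in> C \<Longrightarrow> dist a b < e"
    using assms[OF e(1)] by metis
  define u where "u = K \<inter> - \<Union>{C\<in>\<F>. x \<notin> C}"
  have "closed (\<Union>{C\<in>\<F>. x \<notin> C})" using F by (intro closed_Union) auto
  then have op: "openin (top_of_set K) u"
    unfolding u_def by (intro openin_open_Int) (simp add: open_closed)
  have xK: "x \<in> K" using v x by (auto dest: openin_imp_subset)
  have small: "C \<subseteq> v" if "C \<in> \<F>" "x \<in> C" for C
    using F that e by blast
  have "\<exists>C. connected C \<and> C \<subseteq> v \<and> x \<in> C \<and> y \<in> C" if "y \<in> u" for y
  proof -
    have "y \<in> \<Union>\<F>" using that F(2) unfolding u_def by blast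
    then obtain C where "C \<in> \<F>" "y \<in> C" by blast
    moreover have "x \<in> C" using that calculation unfolding u_def by blast
    ultimately show ?thesis using small F by blast
  qed
  then show "\<exists>u. openin (top_of_set K) u \<and> x \<in> u \<and> u \<subseteq> v \<and>
      (\<forall>y. y \<in> u \<longrightarrow> (\<exists>c. connected c \<and> c \<subseteq> v \<and> x \<in> c \<and> y \<in> c))"
    by (intro exI[of _ u] conjI op) (use xK u_def in blast)+
qed

text \<open>
  Reparametrise the loop so that it starts at the removed point.
\<close>

lemma connected_loop_minus_point:
  fixes g :: "real \<Rightarrow> 'a::topological_space"
  assumes "simple_path g" "pathstart g = pathfinish g"
  shows "connected (path_image g - {p})"
proof (cases "p \<in> path_image g")
  case False
  then show ?thesis using assms by (simp add: connected_simple_path_image)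
next
  case True
  then obtain a where a: "a \<in> {0..1}" "p = g a" by (auto simp: path_image_def)
  have "simple_path (shiftpath a g)"
    using assms a by (intro simple_path_shiftpath) auto
  from connected_simple_path_endless[OF this] show ?thesis
    using a assms by (simp add: endpoints_shiftpath path_image_shiftpath)
qed

lemma simple_path_start_neq_middle:
  assumes "simple_path g"
  shows "g 0 \<noteq> g (1/2)"
proof
  assume "g 0 = g (1/2)"
  moreover have "0 \<in> {0..1::real}" "1/2 \<in> {0..1::real}" by simp_all
  ultimately have "(0::real) = 1/2 \<or> (0::real) = 0 \<and> (1/2::real) = 1 \<or> (0::real) = 1 \<and> (1/2::real) = 0"
    using assms unfolding simple_path_def loop_free_def by blast
  then show False by simp
qed

text \<open>
  A simple loop cannot cross a cut point: deleting the common point of the two closed sets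
  leaves the loop connected, hence on one side, and that side is closed.
\<close>

lemma simple_loop_in_one_point_union:
  fixes g :: "real \<Rightarrow> 'a::t1_space"
  assumes g: "simple_path g" "pathstart g = pathfinish g"
    and sub: "path_image g \<subseteq> X \<union> Y" and cl: "closed X" "closed Y" and one: "X \<inter> Y \<subseteq> {p}"
  shows "path_image g \<subseteq> X \<or> path_image g \<subseteq> Y"
proof -
  have conn: "connected (path_image g)" using g by (simp add: connected_simple_path_image)
  have ne: "\<not> path_image g \<subseteq> {p}"
  proof
    assume *: "path_image g \<subseteq> {p}"
    have "g 0 \<in> path_image g" "g (1/2) \<in> path_image g" by (auto simp: path_image_def)
    with * have "g 0 = g (1/2)" by blast
    with simple_path_start_neq_middle[OF g(1)] show False by simp
  qed
  have fill: "path_image g \<subseteq> Z" if "closed Z" "path_image g - {p} \<subseteq> Z" for Z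
  proof (rule ccontr)
    assume "\<not> ?thesis"
    with that have "p \<in> path_image g" "p \<notin> Z" by auto
    then have "closed {p}" "path_image g \<subseteq> Z \<union> {p}" "Z \<inter> {p} \<inter> path_image g = {}"
        "Z \<inter> path_image g \<noteq> {}" "{p} \<inter> path_image g \<noteq> {}"
      using that ne by auto
    then show False using conn that(1) unfolding connected_closed by blast
  qed
  let ?M = "path_image g - {p}"
  have "X \<inter> ?M = {} \<or> Y \<inter> ?M = {}"
    using connected_loop_minus_point[OF g, of p, unfolded connected_closed] cl sub one by blast
  then have "?M \<subseteq> Y \<or> ?M \<subseteq> X" using sub by blast
  then show ?thesis using fill cl by blast
qed

section \<open>Ternary expansions and a dense orbit in the Cantor set\<close>

text \<open>
  The value at \<open>Ih\<close> is a dummy; it keeps the ternary value of every code in the unit interval.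
\<close>

fun digit :: "index \<Rightarrow> nat" where
  "digit I1 = 0" | "digit I2 = 1" | "digit I3 = 2" | "digit Ih = 0"

lemma digit_le: "digit i \<le> 2" by (cases i) auto

definition ternary_value :: "index stream \<Rightarrow> real" where
  "ternary_value \<alpha> = (\<Sum>n. real (digit (\<alpha> !! n)) / 3 ^ Suc n)"

lemma geometric_majorant: "(\<lambda>n. 2 / 3 ^ Suc n :: real) sums 1"
  using sums_mult[OF geometric_sums[of "1/3::real"], of "2/3"] by (simp add: power_divide)

lemma summable_digits: "summable (\<lambda>n. real (digit (\<alpha> !! n)) / 3 ^ Suc n)"
proof (rule summable_comparison_test')
  show "summable (\<lambda>n. 2 / 3 ^ Suc n :: real)" using geometric_majorant by (rule sums_summable)
  show "norm (real (digit (\<alpha> !! n)) / 3 ^ Suc n) \<le> 2 / 3 ^ Suc n" for n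
    using digit_le[of "\<alpha> !! n"] by (simp add: divide_right_mono)
qed

lemma ternary_value_bounds: "0 \<le> ternary_value \<alpha>" "ternary_value \<alpha> \<le> 1"
proof -
  show "0 \<le> ternary_value \<alpha>" unfolding ternary_value_def by (intro suminf_nonneg summable_digits) simp
  have "ternary_value \<alpha> \<le> (\<Sum>n. 2 / 3 ^ Suc n)" unfolding ternary_value_def
    using digit_le by (intro suminf_le summable_digits sums_summable[OF geometric_majorant])
      (simp add: divide_right_mono)
  then show "ternary_value \<alpha> \<le> 1" using geometric_majorant by (simp add: sums_iff)
qed

lemma ternary_value_SCons: "ternary_value (i ## \<alpha>) = (ternary_value \<alpha> + real (digit i)) / 3"
proof -
  have "ternary_value (i ## \<alpha>) = (\<Sum>n. real (digit (\<alpha> !! n)) / 3 ^ Suc (Suc n)) + real (digit i) / 3"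
    using suminf_split_head[OF summable_digits[of "i ## \<alpha>"]] unfolding ternary_value_def by simp
  also have "(\<Sum>n. real (digit (\<alpha> !! n)) / 3 ^ Suc (Suc n)) = ternary_value \<alpha> / 3"
    unfolding ternary_value_def by (subst suminf_divide[OF summable_digits, symmetric]) (simp add: field_simps)
  finally show ?thesis by (simp add: add_divide_distrib)
qed

lemma power3_ternary_value: "\<exists>k::int. 3 ^ n * ternary_value \<alpha> = of_int k + ternary_value (sdrop n \<alpha>)"
proof (induction n arbitrary: \<alpha>)
  case 0
  show ?case by (intro exI[of _ 0]) simp
next
  case (Suc n)
  obtain i \<beta> where \<alpha>: "\<alpha> = i ## \<beta>" by (cases \<alpha>)
  obtain k :: int where "3 ^ n * ternary_value \<beta> = k + ternary_value (sdrop n \<beta>)" using Suc by blast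
  then have "3 ^ Suc n * ternary_value \<alpha> = of_int (k + 3 ^ n * int (digit i)) + ternary_value (sdrop (Suc n) \<alpha>)"
    unfolding \<alpha> ternary_value_SCons by (simp add: field_simps)
  then show ?case by blast
qed

text \<open>
  A point of the \<open>n\<close>-th stage lies in one of its intervals, and the digits of the left end of that
  interval form a word all of whose continuations have values in the same interval.
\<close>

lemma cantor_stage_ternary_word:
  assumes "x \<in> cantor_stage n"
  shows "\<exists>w. set w \<subseteq> {I1, I3} \<and> length w = n \<and> (\<forall>\<alpha>. \<bar>ternary_value (w @- \<alpha>) - x\<bar> \<le> (1/3) ^ n)"
  using assms
proof (induction n arbitrary: x)
  case 0
  have "\<bar>ternary_value \<alpha> - x\<bar> \<le> 1" for \<alpha>
    using 0 ternary_value_bounds[of \<alpha>] by (simp add: abs_le_iff)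
  then show ?case by simp
next
  case (Suc n)
  from Suc.prems have "\<exists>y\<in>cantor_stage n. \<exists>i\<in>{I1, I3}. x = (y + real (digit i)) / 3"
    by auto
  then obtain i y where iy: "y \<in> cantor_stage n" "i \<in> {I1, I3}" "x = (y + real (digit i)) / 3"
    by blast
  obtain w where w: "set w \<subseteq> {I1, I3}" "length w = n" "\<And>\<alpha>. \<bar>ternary_value (w @- \<alpha>) - y\<bar> \<le> (1/3) ^ n"
    using Suc.IH[OF iy(1)] by blast
  have "\<bar>ternary_value ((i # w) @- \<alpha>) - x\<bar> \<le> (1/3) ^ Suc n" for \<alpha>
    using w(3)[of \<alpha>] by (simp add: ternary_value_SCons iy(3) abs_le_iff field_simps)
  then show ?case using w iy(2) by (intro exI[of _ "i # w"]) auto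
qed

lemma cantor_set_infinite: "infinite cantor_set"
proof -
  have z: "0 \<in> cantor_stage m" for m by (induction m) (auto intro: image_eqI[of _ _ 0])
  have "(1/3) ^ n \<in> cantor_stage m" for n m
  proof (induction n arbitrary: m)
    case 0
    show ?case by (induction m) (auto intro: image_eqI[of _ _ 1])
  next
    case (Suc n)
    show ?case
    proof (cases m)
      case 0
      have "(1/3) ^ Suc n \<le> (1::real)" by (intro power_le_one) simp_all
      then show ?thesis using 0 by simp
    next
      case (Suc m')
      then show ?thesis using Suc.IH[of m'] by (auto intro!: image_eqI[of _ _ "(1/3)^n"])
    qed
  qed
  then have "range (\<lambda>n. (1/3::real) ^ n) \<subseteq> cantor_set" unfolding cantor_set_def by auto
  moreover have "infinite (range (\<lambda>n. (1/3::real) ^ n))"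
    by (intro range_inj_infinite injI) (simp add: power_inject_exp')
  ultimately show ?thesis using infinite_super by blast
qed

text \<open>
  The leading entry \<open>True\<close> only makes all the blocks non-empty, as needed to flatten the stream.
\<close>

definition words :: "bool list stream" where
  "words = smap (\<lambda>n. True # from_nat n) nats"

definition dense_code :: "index stream" where
  "dense_code = smap (\<lambda>b. if b then I1 else I3) (flat words)"

lemma sdrop_flat: "\<forall>xs \<in> sset s. xs \<noteq> [] \<Longrightarrow> \<exists>k. sdrop k (flat s) = flat (sdrop n s)"
proof (induction n arbitrary: s)
  case 0 then show ?case by (intro exI[of _ 0]) simp
next
  case (Suc n)
  obtain xs s' where s: "s = xs ## s'" by (cases s)
  with Suc.prems have "xs \<noteq> []" "\<forall>xs \<in> sset s'. xs \<noteq> []" by auto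
  from Suc.IH[OF this(2)] obtain k where "sdrop k (flat s') = flat (sdrop n s')" by blast
  then have "sdrop (length xs + k) (flat s) = flat (sdrop (Suc n) s)"
    using \<open>xs \<noteq> []\<close> by (simp add: s sdrop_shift)
  then show ?case by blast
qed

lemma flat_words_contains: "\<exists>k \<alpha>. sdrop k (flat words) = w @- \<alpha>"
proof -
  have "\<forall>xs \<in> sset words. xs \<noteq> []" by (auto simp: words_def stream.set_map)
  then obtain k where k: "sdrop k (flat words) = flat (sdrop (to_nat w) words)"
    using sdrop_flat by blast
  have "shd (sdrop (to_nat w) words) = True # w"
    by (simp add: words_def flip: snth.simps(1))
  then have "flat (sdrop (to_nat w) words) = (True # w) @- flat (stl (sdrop (to_nat w) words))"
    using flat_unfold[of "sdrop (to_nat w) words"] by (simp only: list.distinct simp_thms)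
  then have "stl (sdrop k (flat words)) = w @- flat (stl (sdrop (to_nat w) words))"
    by (simp only: k shift.simps stream.sel)
  then have "sdrop (Suc k) (flat words) = w @- flat (stl (sdrop (to_nat w) words))"
    by (simp only: sdrop.simps(2) sdrop_stl)
  then show ?thesis by blast
qed

lemma dense_code_letters: "dense_code !! n \<in> {I1, I3}"
  by (simp add: dense_code_def)

lemma dense_code_contains:
  assumes "set w \<subseteq> {I1, I3}"
  shows "\<exists>k \<alpha>. sdrop k dense_code = w @- \<alpha>"
proof -
  obtain k \<alpha> where "sdrop k (flat words) = map (\<lambda>i. i = I1) w @- \<alpha>"
    using flat_words_contains by blast
  then have "sdrop k dense_code = map ((\<lambda>b. if b then I1 else I3) \<circ> (\<lambda>i. i = I1)) w
      @- smap (\<lambda>b. if b then I1 else I3) \<alpha>"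
    by (simp add: dense_code_def)
  also have "map ((\<lambda>b. if b then I1 else I3) \<circ> (\<lambda>i. i = I1)) w = w"
    using assms by (intro map_idI) auto
  finally show ?thesis by blast
qed

section \<open>The four similarities\<close>

text \<open>
  The initial digit 1 moves the root off the Cantor set. The digits 0 and 2 that follow keep it away
  from the ends of the middle third, even if all the digits of \<open>dense_code\<close> are extreme.
\<close>

definition root_code :: "index stream" where
  "root_code = I2 ## I1 ## I3 ## dense_code"

definition hair_root :: real where
  "hair_root = ternary_value root_code"

lemma root_bounds: "11/27 \<le> hair_root" "hair_root \<le> 12/27"
  using ternary_value_bounds[of dense_code] by (simp_all add: hair_root_def root_code_def ternary_value_SCons)

lemma root_code_letters: "n \<ge> 1 \<Longrightarrow> root_code !! n \<in> {I1, I3}"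
proof -
  have "root_code !! Suc m \<in> {I1, I3}" for m
  proof (cases m)
    case (Suc k)
    then show ?thesis using dense_code_letters by (cases k) (auto simp: root_code_def)
  qed (simp add: root_code_def)
  then show "n \<ge> 1 \<Longrightarrow> ?thesis" by (metis One_nat_def Suc_le_D)
qed

lemma ternary_value_shift_root_code:
  assumes "n \<ge> 1"
  shows "ternary_value (sdrop n root_code) \<in> {0..1/3} \<union> {2/3..1}"
proof -
  obtain i \<beta> where s: "sdrop n root_code = i ## \<beta>" by (cases "sdrop n root_code")
  then have "i = root_code !! n" by (metis sdrop_simps(1) stream.sel(1))
  then have "i \<in> {I1, I3}" using root_code_letters[OF assms] by simp
  then show ?thesis using ternary_value_bounds[of \<beta>] by (auto simp: s ternary_value_SCons)
qed

text \<open>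
  Modulo one, \<open>3 ^ n * hair_root\<close> has an expansion that begins with 0 or 2, whereas \<open>hair_root\<close> is well
  inside the middle third. The integer \<open>k\<close> is arbitrary because the hairs in question are attached
  at all the points \<open>(hair_root + k) / 3 ^ n\<close>.
\<close>

lemma root_nonrecurrent:
  fixes k :: int
  assumes "n \<ge> 1"
  shows "2/27 \<le> \<bar>3 ^ n * hair_root - hair_root - k\<bar>"
proof -
  obtain m :: int where m: "3 ^ n * hair_root = m + ternary_value (sdrop n root_code)"
    using power3_ternary_value unfolding hair_root_def by blast
  define t where "t = ternary_value (sdrop n root_code)"
  have t: "t \<in> {0..1/3} \<union> {2/3..1}" unfolding t_def using ternary_value_shift_root_code[OF assms] .
  have eq: "3 ^ n * hair_root - hair_root - k = t - hair_root + real_of_int (m - k)" using m by (simp add: t_def)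
  consider "m - k \<le> -1" | "m - k = 0" | "m - k \<ge> 1" by linarith
  then show ?thesis
  proof cases
    case 1
    then have "real_of_int (m - k) \<le> -1" by linarith
    then show ?thesis unfolding eq using t root_bounds by auto
  next
    case 2
    then have "real_of_int (m - k) = 0" by linarith
    then show ?thesis unfolding eq using t root_bounds by auto
  next
    case 3
    then have "real_of_int (m - k) \<ge> 1" by linarith
    then show ?thesis unfolding eq using t root_bounds by auto
  qed
qed

text \<open>
  The ratio 1/81 of the hair is chosen so that 2/81 is less than the constant 2/27 by which the orbit
  of the root avoids the root.
\<close>

definition hairy_map :: "index \<Rightarrow> real \<times> real \<Rightarrow> real \<times> real" where
  "hairy_map i p = (if i = Ih then (hair_root - snd p / 81, fst p / 81)
                else ((fst p + digit i) / 3, snd p / 3))"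

definition hairy_inv :: "index \<Rightarrow> real \<times> real \<Rightarrow> real \<times> real" where
  "hairy_inv i p = (if i = Ih then (81 * snd p, 81 * (hair_root - fst p))
                    else (3 * fst p - digit i, 3 * snd p))"

lemma hairy_inv_hairy [simp]: "hairy_inv i (hairy_map i p) = p"
  by (simp add: hairy_map_def hairy_inv_def prod_eq_iff field_simps)

lemma hairy_hairy_inv [simp]: "hairy_map i (hairy_inv i p) = p"
  by (simp add: hairy_map_def hairy_inv_def prod_eq_iff field_simps)

lemma continuous_hairy: "continuous_on A (hairy_map i)"
  unfolding hairy_map_def by (cases "i = Ih") (auto intro!: continuous_intros)

lemma continuous_hairy_inv: "continuous_on A (hairy_inv i)"
  unfolding hairy_inv_def by (cases "i = Ih") (auto intro!: continuous_intros)

lemma dist_hairy: "dist (hairy_map i p) (hairy_map i q) = (if i = Ih then 1/81 else 1/3) * dist p q"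
proof -
  obtain x y u v where pq: "p = (x, y)" "q = (u, v)" by (cases p, cases q)
  have "sqrt ((y - v)\<^sup>2 / 81\<^sup>2 + (x - u)\<^sup>2 / 81\<^sup>2) = sqrt ((x - u)\<^sup>2 + (y - v)\<^sup>2) / 81"
    by (simp add: real_sqrt_divide add.commute flip: add_divide_distrib)
  moreover have "sqrt ((x - u)\<^sup>2 / 3\<^sup>2 + (y - v)\<^sup>2 / 3\<^sup>2) = sqrt ((x - u)\<^sup>2 + (y - v)\<^sup>2) / 3"
    by (simp add: real_sqrt_divide flip: add_divide_distrib)
  ultimately show ?thesis
    by (simp add: pq hairy_map_def dist_Pair_Pair dist_real_def power_divide flip: diff_divide_distrib)
      (simp add: power2_commute)
qed

lemma dist_hairy_le: "dist (hairy_map i p) (hairy_map i q) \<le> dist p q / 3"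
  by (simp add: dist_hairy)

lemma contraction_similarity_hairy: "contraction_similarity (hairy_map i)"
  unfolding contraction_similarity_def
  by (rule exI[of _ "if i = Ih then 1/81 else 1/3"]) (simp add: dist_hairy)

text \<open>
  The compositions of \<open>n\<close> segment maps are of this form with \<open>0 \<le> k < 3 ^ n\<close>.
\<close>

definition triadic :: "nat \<Rightarrow> int \<Rightarrow> real \<times> real \<Rightarrow> real \<times> real" where
  "triadic n k p = ((fst p + k) / 3 ^ n, snd p / 3 ^ n)"

lemma hairy_I2_eq_triadic: "hairy_map I2 = triadic 1 1"
  by (auto simp: hairy_map_def triadic_def)

lemma triadic_hairy: "i \<noteq> Ih \<Longrightarrow> triadic n k (hairy_map i p) = triadic (Suc n) (3 * k + digit i) p"
  by (simp add: hairy_map_def triadic_def field_simps)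

text \<open>
  The square whose diagonal is the unit segment. It narrows linearly to a point at the end 0,
  which is the end by which hairs are attached.
\<close>

definition diamond :: "(real \<times> real) set" where
  "diamond = {p. \<bar>snd p\<bar> \<le> fst p \<and> \<bar>snd p\<bar> \<le> 1 - fst p}"

definition open_diamond :: "(real \<times> real) set" where
  "open_diamond = {p. \<bar>snd p\<bar> < fst p \<and> \<bar>snd p\<bar> < 1 - fst p}"

lemma hairy_diamond: "p \<in> diamond \<Longrightarrow> hairy_map i p \<in> diamond"
  using root_bounds by (cases i) (auto simp: hairy_map_def diamond_def abs_le_iff field_simps)

lemma hairy_open_diamond: "p \<in> open_diamond \<Longrightarrow> hairy_map i p \<in> open_diamond"
  using root_bounds by (cases i) (auto simp: hairy_map_def open_diamond_def abs_less_iff field_simps)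

lemma closed_diamond: "closed diamond"
  unfolding diamond_def by (intro closed_Collect_conj closed_Collect_le continuous_intros)

lemma diamond_dist: "p \<in> diamond \<Longrightarrow> q \<in> diamond \<Longrightarrow> dist p q \<le> 2"
proof -
  assume "p \<in> diamond" "q \<in> diamond"
  then have "\<bar>fst p - fst q\<bar> \<le> 1" "\<bar>snd p - snd q\<bar> \<le> 1" unfolding diamond_def by auto
  moreover have "dist p q \<le> \<bar>fst p - fst q\<bar> + \<bar>snd p - snd q\<bar>"
    by (simp add: dist_prod_def dist_real_def sqrt_sum_squares_le_sum_abs)
  ultimately show ?thesis by simp
qed

lemma hair_coords:
  assumes "p \<in> hairy_map Ih ` diamond"
  shows "\<bar>fst p - hair_root\<bar> \<le> snd p" "snd p \<le> 1/81"
  using assms by (auto simp: hairy_map_def diamond_def)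

text \<open>
  A point common to the hair and its image under \<open>triadic n k\<close> has height at most
  \<open>3 ^ (-n) / 81\<close>. Both hairs are at most that wide at this height, so their roots would be
  closer than \<open>root_nonrecurrent\<close> permits.
\<close>

lemma triadic_image_of_hair_disjoint:
  assumes "n \<ge> 1"
  shows "triadic n k ` hairy_map Ih ` diamond \<inter> hairy_map Ih ` diamond = {}"
proof -
  have False if p: "p \<in> hairy_map Ih ` diamond" and q: "triadic n k p \<in> hairy_map Ih ` diamond" for p
  proof -
    define N :: real where "N = 3 ^ n"
    have N: "N > 0" by (simp add: N_def)
    define a b where "a = fst p - hair_root" and "b = snd p"
    define a' where "a' = (fst p + k) / N - hair_root"
    have ab: "\<bar>a\<bar> \<le> b" "b \<le> 1/81" using hair_coords[OF p] by (auto simp: a_def b_def)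
    have "\<bar>a'\<bar> \<le> b / N"
      using hair_coords[OF q] by (auto simp: a'_def b_def triadic_def N_def)
    then have "N * \<bar>a'\<bar> \<le> b" using N by (simp add: field_simps)
    then have a': "\<bar>N * a'\<bar> \<le> b" using N by (simp add: abs_mult)
    \<comment> \<open>This is the signed distance between the two roots, scaled by N, measured via the common point.\<close>
    have "N * hair_root - hair_root - k = a - N * a'" using N by (simp add: a_def a'_def field_simps)
    moreover have "\<bar>a - N * a'\<bar> \<le> 2/81" using ab a' by linarith
    ultimately show False using root_nonrecurrent[OF assms, of k] by (simp add: N_def)
  qed
  then show ?thesis by blast
qed

text \<open>
  The set \<open>X\<close> is going to be the attractor on the one hand and the open set of the open set
  condition on the other, which is not quite self-covering; hence the half plane in
  the hypothesis. A common point above the axis lies in a piece of \<open>X\<close>, in a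
  subpiece of that piece, and so on. It never enters a subpiece of hair type, because such a subpiece is
  disjoint from the hair of the first level. So all these pieces are images under segment maps alone, and
  they shrink to the axis.
\<close>

lemma middle_piece_meets_hair:
  assumes X: "X \<subseteq> diamond" "X \<subseteq> {p. snd p \<le> 0} \<union> (\<Union>i. hairy_map i ` X)"
    and q: "q \<in> hairy_map I2 ` X" "q \<in> hairy_map Ih ` diamond"
  shows "q = (hair_root, 0)"
proof -
  have "snd q \<le> 0"
  proof (rule ccontr)
    assume pos: "\<not> ?thesis"
    have deep: "\<exists>k. q \<in> triadic (Suc n) k ` X" for n
    proof (induction n)
      case 0
      show ?case using q(1) by (auto simp: hairy_I2_eq_triadic)
    next
      case (Suc n)
      then obtain k p where p: "p \<in> X" "q = triadic (Suc n) k p" by blast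
      have "\<not> snd p \<le> 0" using pos by (auto simp: p(2) triadic_def divide_le_0_iff)
      then obtain i p' where p': "p' \<in> X" "p = hairy_map i p'" using X(2) p(1) by blast
      have "i \<noteq> Ih"
        using triadic_image_of_hair_disjoint[of "Suc n" k] q(2) p p' X(1) by auto
      then show ?case using p' by (auto simp: p(2) triadic_hairy)
    qed
    have height: "snd p \<le> 1" if "p \<in> X" for p using X(1) that by (auto simp: diamond_def)
    have bound: "snd q \<le> (1/3) ^ Suc n" for n
    proof -
      obtain k p where p: "p \<in> X" "q = triadic (Suc n) k p" using deep[of n] by blast
      have "snd p / 3 ^ Suc n \<le> 1 / 3 ^ Suc n"
        using height[OF p(1)] by (intro divide_right_mono) simp_all
      then show ?thesis by (simp only: p(2) triadic_def snd_conv power_one_over)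
    qed
    obtain n where "(1/3::real) ^ n < snd q"
      using real_arch_pow_inv[of "snd q" "1/3"] pos by auto
    moreover have "(1/3::real) ^ Suc n \<le> (1/3) ^ n" by simp
    ultimately show False using bound[of n] by linarith
  qed
  then have "fst q = hair_root" "snd q = 0" using hair_coords[OF q(2)] by linarith+
  then show ?thesis by (simp add: prod_eq_iff)
qed

section \<open>The attractor and its connectedness properties\<close>

text \<open>
  The segment with finitely many generations of hairs. It is self-similar already, and being a
  union of connected sets that all contain the segment it is connected. Both properties pass to
  the closure.
\<close>

inductive_set skeleton :: "(real \<times> real) set" where
  segment: "0 \<le> x \<Longrightarrow> x \<le> 1 \<Longrightarrow> (x, 0) \<in> skeleton"
| image: "p \<in> skeleton \<Longrightarrow> hairy_map i p \<in> skeleton"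

definition brush :: "(real \<times> real) set" where
  "brush = closure skeleton"

lemma UNIV_index: "UNIV = {I1, I2, I3, Ih}"
  using index.exhaust by auto

lemma finite_UNIV_index: "finite (UNIV :: index set)"
  by (simp add: UNIV_index)

lemma skeleton_diamond: "skeleton \<subseteq> diamond"
proof
  show "p \<in> diamond" if "p \<in> skeleton" for p
    using that by induction (auto simp: hairy_diamond, auto simp: diamond_def)
qed

lemma brush_diamond: "brush \<subseteq> diamond"
  unfolding brush_def by (intro closure_minimal skeleton_diamond closed_diamond)

lemma brush_dist: "p \<in> brush \<Longrightarrow> q \<in> brush \<Longrightarrow> dist p q \<le> 2"
  using brush_diamond diamond_dist by blast

lemma segment_brush: "0 \<le> x \<Longrightarrow> x \<le> 1 \<Longrightarrow> (x, 0) \<in> brush"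
  unfolding brush_def using closure_subset skeleton.segment by blast

lemma compact_brush: "compact brush"
proof -
  have "bounded brush"
    unfolding bounded_any_center[of _ "(0, 0)"]
    using brush_dist segment_brush[of 0] by (intro exI[of _ 2]) auto
  then show ?thesis unfolding compact_eq_bounded_closed by (simp add: brush_def)
qed

lemma compact_piece: "compact (hairy_map i ` brush)"
  by (intro compact_continuous_image continuous_hairy compact_brush)

lemma skeleton_eq: "skeleton = (\<Union>i. hairy_map i ` skeleton)"
proof
  show "skeleton \<subseteq> (\<Union>i. hairy_map i ` skeleton)"
  proof
    fix p assume "p \<in> skeleton"
    then show "p \<in> (\<Union>i. hairy_map i ` skeleton)"
    proof cases
      case (segment x)
      consider "x \<le> 1/3" | "1/3 \<le> x" "x \<le> 2/3" | "2/3 \<le> x" by linarith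
      then obtain i where "0 \<le> 3 * x - digit i" "3 * x - digit i \<le> 1" "i \<noteq> Ih"
      proof cases
        case 1 then show ?thesis using that[of I1] segment by simp
      next
        case 2 then show ?thesis using that[of I2] segment by simp
      next
        case 3 then show ?thesis using that[of I3] segment by simp
      qed
      moreover from this have "p = hairy_map i (3 * x - digit i, 0)"
        using segment by (simp add: hairy_map_def)
      ultimately show ?thesis using skeleton.segment by blast
    qed auto
  qed
qed (auto intro: skeleton.image)

lemma closure_hairy_skeleton: "closure (hairy_map i ` skeleton) = hairy_map i ` brush"
proof
  show "closure (hairy_map i ` skeleton) \<subseteq> hairy_map i ` brush"
    unfolding brush_def using compact_piece[of i] closure_subset
    by (intro closure_minimal image_mono compact_imp_closed) (auto simp: brush_def)
  show "hairy_map i ` brush \<subseteq> closure (hairy_map i ` skeleton)"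
    unfolding brush_def by (intro image_closure_subset continuous_hairy closure_subset closed_closure)
qed

lemma brush_eq: "brush = (\<Union>i. hairy_map i ` brush)"
proof -
  have "brush = closure (\<Union>(range (\<lambda>i. hairy_map i ` skeleton)))"
    unfolding brush_def by (subst skeleton_eq) (rule refl)
  also have "\<dots> = (\<Union>i. closure (hairy_map i ` skeleton))"
    unfolding UNIV_index by (simp add: closure_Un)
  finally show ?thesis by (simp only: closure_hairy_skeleton)
qed

lemma is_attractor_brush: "is_attractor hairy_map brush"
  unfolding is_attractor_def
proof (intro conjI)
  show "brush \<noteq> {}" using segment_brush[of 0] by auto
qed (rule compact_brush brush_eq)+

lemma connected_brush: "connected brush"
proof -
  define I :: "(real \<times> real) set" where "I = {0..1} \<times> {0}"
  have "connected I" unfolding I_def by (intro connected_Times) auto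
  have "\<exists>C\<subseteq>skeleton. connected C \<and> I \<subseteq> C \<and> p \<in> C" if "p \<in> skeleton" for p
    using that
  proof induction
    case (segment x)
    then show ?case using \<open>connected I\<close>
      by (intro exI[of _ I]) (auto simp: I_def intro: skeleton.segment)
  next
    case (image p i)
    then obtain C where C: "C \<subseteq> skeleton" "connected C" "I \<subseteq> C" "p \<in> C" by blast
    \<comment> \<open>Every map sends the end 0 into the segment, so the image stays attached to it.\<close>
    have "hairy_map i (0, 0) \<in> I" using root_bounds digit_le[of i] by (auto simp: hairy_map_def I_def)
    moreover have "(0, 0) \<in> C" using C by (auto simp: I_def)
    ultimately have "hairy_map i ` C \<inter> I \<noteq> {}" by blast
    then have "connected (hairy_map i ` C \<union> I)"
      using C \<open>connected I\<close>
      by (intro connected_Un connected_continuous_image continuous_hairy)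
    then show ?case using C
      by (intro exI[of _ "hairy_map i ` C \<union> I"]) (blast intro: skeleton.image)
  qed
  then obtain C where C: "C p \<subseteq> skeleton" "connected (C p)" "I \<subseteq> C p" "p \<in> C p" if "p \<in> skeleton" for p
    by metis
  have "skeleton = (\<Union>p\<in>skeleton. C p)"
  proof
    show "skeleton \<subseteq> (\<Union>p\<in>skeleton. C p)" using C(4) by (intro subsetI UN_I)
    show "(\<Union>p\<in>skeleton. C p) \<subseteq> skeleton" using C(1) by (intro UN_least)
  qed
  moreover have "connected (\<Union>p\<in>skeleton. C p)"
  proof (rule connected_Union)
    have "(0, 0) \<in> I" by (simp add: I_def)
    then have "(0, 0) \<in> \<Inter>(C ` skeleton)" using C(3) by blast
    then show "\<Inter>(C ` skeleton) \<noteq> {}" by blast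
  qed (use C in auto)
  ultimately show ?thesis unfolding brush_def by (simp add: connected_imp_connected_closure)
qed

lemma word_map_simps [simp]:
  "word_map S [] = id" "word_map S (i # w) = S i \<circ> word_map S w"
  by (simp_all add: word_map_def)

lemma word_map_dist: "dist (word_map hairy_map w p) (word_map hairy_map w q) \<le> (1/3) ^ length w * dist p q"
proof (induction w)
  case (Cons i w)
  then show ?case using dist_hairy_le[of i "word_map hairy_map w p" "word_map hairy_map w q"] by simp
qed simp

lemma continuous_word_map: "continuous_on A (word_map hairy_map w)"
proof (induction w)
  case (Cons i w)
  then show ?case
    unfolding word_map_simps by (intro continuous_on_compose continuous_hairy)
qed (simp add: continuous_on_id)

lemma brush_words: "brush = (\<Union>w\<in>{w. length w = n}. word_map hairy_map w ` brush)"
proof (induction n)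
  case (Suc n)
  have "(\<Union>w\<in>{w. length w = Suc n}. word_map hairy_map w ` brush)
      = (\<Union>i. hairy_map i ` (\<Union>w\<in>{w. length w = n}. word_map hairy_map w ` brush))"
    by (force simp: length_Suc_conv)
  also have "\<dots> = brush" by (simp only: Suc.IH[symmetric] brush_eq[symmetric])
  finally show ?case by (rule sym)
qed simp

lemma locally_connected_brush: "locally connected brush"
proof (rule locally_connected_if_small_connected_covers)
  fix e :: real assume "e > 0"
  then obtain n where n: "(1/3::real) ^ n < e / 2" using real_arch_pow_inv[of "e/2" "1/3"] by auto
  let ?F = "(\<lambda>w. word_map hairy_map w ` brush) ` {w. length w = n}"
  have "finite ?F"
    using finite_lists_length_eq[OF finite_UNIV_index, of n] by simp
  moreover have "\<Union>?F = brush" using brush_words[of n] by simp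
  moreover have "closed C \<and> connected C \<and> (\<forall>x\<in>C. \<forall>y\<in>C. dist x y < e)" if "C \<in> ?F" for C
  proof -
    from that obtain w where w: "length w = n" "C = word_map hairy_map w ` brush" by blast
    have "closed C" unfolding w
      by (intro compact_imp_closed compact_continuous_image continuous_word_map compact_brush)
    moreover have "connected C" unfolding w
      by (intro connected_continuous_image continuous_word_map connected_brush)
    moreover have "dist (word_map hairy_map w p) (word_map hairy_map w q) < e" if "p \<in> brush" "q \<in> brush" for p q
    proof -
      have "dist (word_map hairy_map w p) (word_map hairy_map w q) \<le> (1/3) ^ n * 2"
        using word_map_dist[of w p q] mult_left_mono[OF brush_dist[OF that], of "(1/3) ^ n"] w(1)
        by (metis order_trans zero_le_divide_1_iff zero_le_numeral zero_le_power)
      then show ?thesis using n by simp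
    qed
    ultimately show ?thesis unfolding w by blast
  qed
  ultimately show "\<exists>\<F>. finite \<F> \<and> \<Union>\<F> = brush \<and>
      (\<forall>C\<in>\<F>. closed C \<and> connected C \<and> (\<forall>x\<in>C. \<forall>y\<in>C. dist x y < e))"
    by (intro exI[of _ ?F]) blast
qed

section \<open>Intersections of the pieces\<close>

lemma diamond_piece_coords:
  assumes "p \<in> diamond"
  shows "i \<noteq> Ih \<Longrightarrow> \<bar>snd (hairy_map i p)\<bar> \<le> fst (hairy_map i p) - digit i / 3"
    and "i \<noteq> Ih \<Longrightarrow> \<bar>snd (hairy_map i p)\<bar> \<le> (digit i + 1) / 3 - fst (hairy_map i p)"
  using assms by (auto simp: hairy_map_def diamond_def field_simps)

lemma open_diamond_piece_right:
  assumes "p \<in> open_diamond"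
  shows "i \<noteq> Ih \<Longrightarrow> fst (hairy_map i p) < (digit i + 1) / 3"
  using assms by (auto simp: hairy_map_def open_diamond_def field_simps)

text \<open>
  The diamonds of the first level pieces meet in at most one point, except for the middle piece and
  the hair, whose diamonds overlap properly; this last pair needs the finer argument above.
\<close>

lemma diamond_pieces_meet:
  assumes "z \<in> hairy_map i ` diamond" "z \<in> hairy_map j ` diamond" "i \<noteq> j"
  shows "{i, j} = {I1, I2} \<and> z = (1/3, 0) \<or> {i, j} = {I2, I3} \<and> z = (2/3, 0)
    \<or> {i, j} = {I2, Ih}"
proof -
  have coords: "\<bar>snd z\<bar> \<le> fst z - digit k / 3" "\<bar>snd z\<bar> \<le> (digit k + 1) / 3 - fst z"
    if "z \<in> hairy_map k ` diamond" "k \<noteq> Ih" for k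
    using that diamond_piece_coords by auto
  have hair: "1/3 < fst z" "fst z < 2/3" if "z \<in> hairy_map Ih ` diamond"
    using hair_coords[OF that] root_bounds by linarith+
  have *: "{i, j} = {I1, I2} \<and> z = (1/3, 0) \<or> {i, j} = {I2, I3} \<and> z = (2/3, 0)
    \<or> {i, j} = {I2, Ih}"
    if ij: "(i, j) \<in> {(I1, I2), (I1, I3), (I1, Ih), (I2, I3), (I2, Ih), (I3, Ih)}"
      and z: "z \<in> hairy_map i ` diamond" "z \<in> hairy_map j ` diamond" for i j
  proof -
    consider "i = I1" "j = I2" | "i = I1" "j = I3" | "i = I1" "j = Ih" | "i = I2" "j = I3"
      | "i = I2" "j = Ih" | "i = I3" "j = Ih" using ij unfolding insert_iff empty_iff prod.inject by blast
    then show ?thesis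
    proof cases
      case 1
      then have "fst z = 1/3" "snd z = 0" using coords[of I1] coords[of I2] z by auto
      then show ?thesis using 1 by (simp add: prod_eq_iff)
    next
      case 2
      then have False using coords[of I1] coords[of I3] z by auto
      then show ?thesis ..
    next
      case 3
      then have False using coords[of I1] hair z by auto
      then show ?thesis ..
    next
      case 4
      then have "fst z = 2/3" "snd z = 0" using coords[of I2] coords[of I3] z by auto
      then show ?thesis using 4 by (simp add: prod_eq_iff)
    next
      case 6
      then have False using coords[of I3] hair z by auto
      then show ?thesis ..
    qed blast
  qed
  have "(i, j) \<in> {(I1, I2), (I1, I3), (I1, Ih), (I2, I3), (I2, Ih), (I3, Ih)} \<or>
    (j, i) \<in> {(I1, I2), (I1, I3), (I1, Ih), (I2, I3), (I2, Ih), (I3, Ih)}"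
    using assms(3) by (cases i; cases j) simp_all
  then show ?thesis
  proof
    assume "(j, i) \<in> {(I1, I2), (I1, I3), (I1, Ih), (I2, I3), (I2, Ih), (I3, Ih)}"
    from *[OF this assms(2,1)] show ?thesis by (subst (1 2 3) doubleton_eq_iff) (auto simp: doubleton_eq_iff)
  qed (use * assms in blast)
qed

lemma brush_pieces_meet:
  assumes "z \<in> hairy_map i ` brush" "z \<in> hairy_map j ` brush" "i \<noteq> j"
  shows "{i, j} = {I1, I2} \<and> z = (1/3, 0) \<or> {i, j} = {I2, I3} \<and> z = (2/3, 0)
    \<or> {i, j} = {I2, Ih} \<and> z = (hair_root, 0)"
proof -
  have "z \<in> hairy_map i ` diamond" "z \<in> hairy_map j ` diamond" using assms brush_diamond by blast+
  then consider "{i, j} = {I1, I2} \<and> z = (1/3, 0) \<or> {i, j} = {I2, I3} \<and> z = (2/3, 0)"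
    | "{i, j} = {I2, Ih}"
    using diamond_pieces_meet[OF _ _ assms(3)] by blast
  then show ?thesis
  proof cases
    case 2
    then have "z \<in> hairy_map I2 ` brush" "z \<in> hairy_map Ih ` brush"
      using assms by (auto simp: doubleton_eq_iff)
    then have "z = (hair_root, 0)"
      using brush_diamond equalityD1[OF brush_eq] by (intro middle_piece_meets_hair[of brush]) blast+
    then show ?thesis using 2 by blast
  qed blast
qed

lemma one_point_intersection_brush: "one_point_intersection hairy_map brush"
  unfolding one_point_intersection_def
proof (intro allI impI)
  fix i j :: index assume "i \<noteq> j"
  define z where "z = (if {i, j} = {I1, I2} then (1/3, 0)
    else if {i, j} = {I2, I3} then (2/3, 0) else (hair_root, 0::real))"
  have "{I1, I2} \<noteq> {I2, I3}" "{I1, I2} \<noteq> {I2, Ih}" "{I2, I3} \<noteq> {I2, Ih}"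
    by (simp_all add: doubleton_eq_iff)
  then have "x = z" if "x \<in> hairy_map i ` brush" "x \<in> hairy_map j ` brush" for x
    using brush_pieces_meet[OF that \<open>i \<noteq> j\<close>] unfolding z_def by (elim disjE conjE) simp_all
  then have z: "hairy_map i ` brush \<inter> hairy_map j ` brush \<subseteq> {z}" by blast
  from finite_subset[OF z] card_mono[OF _ z]
  show "finite (hairy_map i ` brush \<inter> hairy_map j ` brush) \<and> card (hairy_map i ` brush \<inter> hairy_map j ` brush) \<le> 1"
    by simp
qed

section \<open>Absence of simple loops\<close>

text \<open>
  The first level pieces form a tree: the middle piece has three neighbours, each of which
  meets it in one point, and there are no other contacts. Split off the left piece, the right piece
  and the hair in turn.
\<close>

lemma simple_loop_in_piece:
  assumes g: "simple_path g" "pathstart g = pathfinish g" and sub: "path_image g \<subseteq> brush"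
  shows "\<exists>i. path_image g \<subseteq> hairy_map i ` brush"
proof -
  note cl = compact_imp_closed[OF compact_piece]
  have m12: "x = (1/3, 0)" if "x \<in> hairy_map I1 ` brush" "x \<in> hairy_map I2 ` brush" for x
    using brush_pieces_meet[OF that] by (simp add: doubleton_eq_iff)
  have m13: False if "x \<in> hairy_map I1 ` brush" "x \<in> hairy_map I3 ` brush" for x
    using brush_pieces_meet[OF that] by (simp add: doubleton_eq_iff)
  have m1h: False if "x \<in> hairy_map I1 ` brush" "x \<in> hairy_map Ih ` brush" for x
    using brush_pieces_meet[OF that] by (simp add: doubleton_eq_iff)
  have m23: "x = (2/3, 0)" if "x \<in> hairy_map I2 ` brush" "x \<in> hairy_map I3 ` brush" for x
    using brush_pieces_meet[OF that] by (simp add: doubleton_eq_iff)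
  have m3h: False if "x \<in> hairy_map I3 ` brush" "x \<in> hairy_map Ih ` brush" for x
    using brush_pieces_meet[OF that] by (simp add: doubleton_eq_iff)
  have m2h: "x = (hair_root, 0)" if "x \<in> hairy_map I2 ` brush" "x \<in> hairy_map Ih ` brush" for x
    using brush_pieces_meet[OF that] by (simp add: doubleton_eq_iff)
  let ?A = "hairy_map I1 ` brush" and ?B = "hairy_map I2 ` brush" and ?C = "hairy_map I3 ` brush"
    and ?H = "hairy_map Ih ` brush"
  have 1: "path_image g \<subseteq> ?A \<union> (?C \<union> (?B \<union> ?H))"
    using sub equalityD1[OF brush_eq] unfolding UNIV_index by blast
  have "?A \<inter> (?C \<union> (?B \<union> ?H)) \<subseteq> {(1/3, 0)}" using m12 m13 m1h by blast
  from simple_loop_in_one_point_union[OF g 1 _ _ this] cl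
  consider "path_image g \<subseteq> ?A" | "path_image g \<subseteq> ?C \<union> (?B \<union> ?H)" by (meson closed_Un)
  then show ?thesis
  proof cases
    case 2
    have "?C \<inter> (?B \<union> ?H) \<subseteq> {(2/3, 0)}" using m23 m3h by blast
    from simple_loop_in_one_point_union[OF g 2 _ _ this] cl
    consider "path_image g \<subseteq> ?C" | "path_image g \<subseteq> ?B \<union> ?H" by (meson closed_Un)
    then show ?thesis
    proof cases
      case 2
      have "?B \<inter> ?H \<subseteq> {(hair_root, 0)}" using m2h by blast
      from simple_loop_in_one_point_union[OF g 2 cl cl this] show ?thesis by blast
    qed blast
  qed blast
qed

text \<open>
  The loop lies in one piece, and blown up it is a loop in the attractor at least three times as
  large, to which the induction hypothesis applies.
\<close>

lemma simple_loop_dist: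
  assumes "simple_path g" "pathstart g = pathfinish g" "path_image g \<subseteq> brush" "a \<in> {0..1}" "b \<in> {0..1}"
  shows "dist (g a) (g b) \<le> 2 * (1/3) ^ n"
  using assms
proof (induction n arbitrary: g)
  case 0
  then have "g a \<in> brush" "g b \<in> brush" by (auto simp: path_image_def)
  then show ?case using brush_dist by simp
next
  case (Suc n)
  obtain i where i: "path_image g \<subseteq> hairy_map i ` brush"
    using simple_loop_in_piece Suc.prems by blast
  let ?h = "hairy_inv i \<circ> g"
  have "simple_path ?h"
    using Suc.prems by (intro simple_path_continuous_image continuous_hairy_inv)
      (auto intro!: inj_onI dest: arg_cong[of _ _ "hairy_map i"])
  moreover have "pathstart ?h = pathfinish ?h"
    using Suc.prems by (simp add: pathstart_compose pathfinish_compose)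
  moreover have "path_image ?h \<subseteq> brush" using i by (auto simp: path_image_compose)
  ultimately have "dist (?h a) (?h b) \<le> 2 * (1/3) ^ n" using Suc by blast
  then show ?case using dist_hairy_le[of i "?h a" "?h b"] by simp
qed

lemma no_simple_loop_brush:
  "\<not> (\<exists>g. simple_path g \<and> pathstart g = pathfinish g \<and> path_image g \<subseteq> brush)"
proof
  assume "\<exists>g. simple_path g \<and> pathstart g = pathfinish g \<and> path_image g \<subseteq> brush"
  then obtain g where g: "simple_path g" "pathstart g = pathfinish g" "path_image g \<subseteq> brush" by blast
  from simple_path_start_neq_middle[OF g(1)] obtain n where "(1/3::real) ^ n < dist (g 0) (g (1/2)) / 2"
    using real_arch_pow_inv[of "dist (g 0) (g (1/2)) / 2" "1/3"] by auto
  moreover have "dist (g 0) (g (1/2)) \<le> 2 * (1/3) ^ n"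
    using g by (intro simple_loop_dist) auto
  ultimately show False by simp
qed

section \<open>The open set condition\<close>

text \<open>
  The images of the open lower half of the diamond. The interior of the whole diamond would not do,
  since the hair stands on the upper side of the middle piece and so lies inside its diamond near
  the root.
\<close>

inductive_set foliage :: "(real \<times> real) set" where
  leaf: "p \<in> open_diamond \<Longrightarrow> snd p < 0 \<Longrightarrow> p \<in> foliage"
| image: "p \<in> foliage \<Longrightarrow> hairy_map i p \<in> foliage"

lemma foliage_open_diamond: "foliage \<subseteq> open_diamond"
proof
  show "p \<in> open_diamond" if "p \<in> foliage" for p
    using that by induction (auto simp: hairy_open_diamond)
qed

lemma foliage_diamond: "foliage \<subseteq> diamond"
  using foliage_open_diamond by (auto simp: open_diamond_def diamond_def)

lemma open_foliage: "open foliage"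
proof -
  have "\<exists>V. open V \<and> p \<in> V \<and> V \<subseteq> foliage" if "p \<in> foliage" for p
    using that
  proof induction
    case (leaf p)
    have "open (open_diamond \<inter> {p. snd p < 0})"
      unfolding open_diamond_def
      by (intro open_Int open_Collect_conj open_Collect_less continuous_intros)
    then show ?case using leaf
      by (intro exI[of _ "open_diamond \<inter> {p. snd p < 0}"]) (auto intro: foliage.leaf)
  next
    case (image p i)
    then obtain V where V: "open V" "p \<in> V" "V \<subseteq> foliage" by blast
    have "hairy_map i ` V = hairy_inv i -` V" by (auto intro: image_eqI[of _ _ "hairy_inv i _"])
    then have "open (hairy_map i ` V)" using V(1) by (simp add: open_vimage continuous_hairy_inv)
    then show ?case using V by (intro exI[of _ "hairy_map i ` V"]) (blast intro: foliage.image)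
  qed
  then show ?thesis by (subst open_subopen) blast
qed

lemma foliage_I2_Ih_disjoint: "hairy_map I2 ` foliage \<inter> hairy_map Ih ` foliage = {}"
proof -
  have False if q: "q \<in> hairy_map I2 ` foliage" "q \<in> hairy_map Ih ` foliage" for q
  proof -
    have "foliage \<subseteq> {p. snd p \<le> 0} \<union> (\<Union>i. hairy_map i ` foliage)"
    proof
      fix p assume "p \<in> foliage"
      then show "p \<in> {p. snd p \<le> 0} \<union> (\<Union>i. hairy_map i ` foliage)" by cases auto
    qed
    then have "q = (hair_root, 0)" using q foliage_diamond by (intro middle_piece_meets_hair[of foliage]) blast+
    moreover have "snd q > 0" using q(2) foliage_open_diamond by (auto simp: hairy_map_def open_diamond_def)
    ultimately show False by simp
  qed
  then show ?thesis by blast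
qed

lemma open_set_condition_hairy: "open_set_condition hairy_map"
  unfolding open_set_condition_def
proof (intro exI[of _ foliage] conjI allI impI)
  show "open foliage" by (rule open_foliage)
  have "(1/2, -1/4) \<in> foliage" by (intro foliage.leaf) (auto simp: open_diamond_def)
  then show "foliage \<noteq> {}" by blast
  show "hairy_map i ` foliage \<subseteq> foliage" for i by (auto intro: foliage.image)
  show "hairy_map i ` foliage \<inter> hairy_map j ` foliage = {}" if "i \<noteq> j" for i j
  proof (cases "{i, j} = {I2, Ih}")
    case True
    then show ?thesis using foliage_I2_Ih_disjoint by (auto simp: doubleton_eq_iff)
  next
    case False
    \<comment> \<open>The contact points of neighbouring diamonds are corners, which the open diamonds omit.\<close>
    have right: "fst z < (digit k + 1) / 3" if "z \<in> hairy_map k ` foliage" "k \<noteq> Ih" for z k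
      using that open_diamond_piece_right foliage_open_diamond by blast
    have no: False if z: "z \<in> hairy_map i ` foliage" "z \<in> hairy_map j ` foliage" for z
    proof -
      have "z \<in> hairy_map i ` diamond" "z \<in> hairy_map j ` diamond" using z foliage_diamond by blast+
      from diamond_pieces_meet[OF this \<open>i \<noteq> j\<close>] show False
      proof (elim disjE conjE)
        assume "{i, j} = {I1, I2}" and eq: "z = (1/3, 0)"
        then have "z \<in> hairy_map I1 ` foliage" using z by (auto simp: doubleton_eq_iff)
        then show False using right[of z I1] eq by simp
      next
        assume "{i, j} = {I2, I3}" and eq: "z = (2/3, 0)"
        then have "z \<in> hairy_map I2 ` foliage" using z by (auto simp: doubleton_eq_iff)
        then show False using right[of z I2] eq by simp
      qed (use False in contradiction)
    qed
    show ?thesis using no by blast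
  qed
qed

section \<open>Addresses and the post-critical set\<close>

lemma address_map_eqI:
  assumes "\<And>n. x \<in> word_map hairy_map (stake n \<alpha>) ` brush"
  shows "address_map hairy_map brush \<alpha> = x"
  unfolding address_map_def
proof (rule the_equality)
  show "x \<in> (\<Inter>n\<in>{1..}. word_map hairy_map (stake n \<alpha>) ` brush)" using assms by blast
  fix y assume y: "y \<in> (\<Inter>n\<in>{1..}. word_map hairy_map (stake n \<alpha>) ` brush)"
  show "y = x"
  proof (rule ccontr)
    assume "y \<noteq> x"
    then obtain n where n: "(1/3::real) ^ n < dist x y / 2"
      using real_arch_pow_inv[of "dist x y / 2" "1/3"] by auto
    obtain p where p: "p \<in> brush" "x = word_map hairy_map (stake (Suc n) \<alpha>) p" using assms by blast
    have "y \<in> word_map hairy_map (stake (Suc n) \<alpha>) ` brush" using y by (rule INT_D) simp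
    then obtain q where q: "q \<in> brush" "y = word_map hairy_map (stake (Suc n) \<alpha>) q" by blast
    have "dist x y \<le> (1/3) ^ Suc n * dist p q"
      using word_map_dist[of "stake (Suc n) \<alpha>" p q] by (simp only: p q length_stake)
    also have "\<dots> \<le> (1/3) ^ Suc n * 2" using brush_dist[OF p(1) q(1)] by (intro mult_left_mono) auto
    also have "\<dots> \<le> (1/3) ^ n * 2" by simp
    finally show False using n by simp
  qed
qed

lemma address_map_ternary:
  assumes "Ih \<notin> sset \<alpha>"
  shows "address_map hairy_map brush \<alpha> = (ternary_value \<alpha>, 0)"
proof (rule address_map_eqI)
  fix n
  have "word_map hairy_map (stake n \<alpha>) (ternary_value (sdrop n \<alpha>), 0) = (ternary_value \<alpha>, 0)"
    using assms
  proof (induction n arbitrary: \<alpha>)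
    case (Suc n)
    obtain i \<beta> where \<alpha>: "\<alpha> = i ## \<beta>" by (cases \<alpha>)
    then show ?case using Suc.IH[of \<beta>] Suc.prems by (auto simp: hairy_map_def ternary_value_SCons)
  qed simp
  then show "(ternary_value \<alpha>, 0) \<in> word_map hairy_map (stake n \<alpha>) ` brush"
    using segment_brush[OF ternary_value_bounds] by (metis imageI)
qed

lemma root_code_ternary: "Ih \<notin> sset root_code"
proof
  assume "Ih \<in> sset root_code"
  then have "Ih \<in> sset dense_code" by (simp add: root_code_def)
  then obtain n where "dense_code !! n = Ih" unfolding sset_range by (metis rangeE)
  then show False using dense_code_letters[of n] by simp
qed

lemma root_in_overlap_set: "(hair_root, 0) \<in> overlap_set hairy_map brush"
proof -
  \<comment> \<open>The root is the lower end of the hair. As its expansion begins with 1, the middle piece contains it.\<close>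
  have "(hair_root, 0) = hairy_map Ih (0, 0)" by (simp add: hairy_map_def)
  moreover have "(hair_root, 0) = hairy_map I2 (ternary_value (stl root_code), 0)"
    by (simp add: hairy_map_def hair_root_def root_code_def ternary_value_SCons)
  ultimately have "(hair_root, 0) \<in> hairy_map I2 ` brush \<inter> hairy_map Ih ` brush"
    using segment_brush[of 0] segment_brush[OF ternary_value_bounds]
    by (metis IntI imageI order_refl zero_le_one)
  then show ?thesis unfolding overlap_set_def by blast
qed

lemma post_critical_shift: "1 \<le> k \<Longrightarrow> sdrop k root_code \<in> post_critical_set hairy_map brush"
  unfolding post_critical_set_def mem_Collect_eq
  using address_map_ternary[OF root_code_ternary] root_in_overlap_set
  by (intro exI[of _ k] exI[of _ root_code]) (simp add: hair_root_def)

lemma address_shift: "address_map hairy_map brush (sdrop k root_code) = (ternary_value (sdrop k root_code), 0)"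
proof (rule address_map_ternary)
  show "Ih \<notin> sset (sdrop k root_code)"
    using root_code_ternary by (auto simp: sset_range sdrop_snth)
qed

text \<open>
  Every finite word over the digits 0 and 2 occurs in the code of the root, so some shift of that
  code agrees with a given point of the Cantor set to any prescribed precision.
\<close>

lemma cantor_set_closure:
  "cantor_set \<times> {0} \<subseteq> closure (address_map hairy_map brush ` post_critical_set hairy_map brush)"
proof
  fix p assume "p \<in> cantor_set \<times> {0::real}"
  then obtain x where x: "p = (x, 0)" "x \<in> cantor_set" by blast
  show "p \<in> closure (address_map hairy_map brush ` post_critical_set hairy_map brush)"
    unfolding closure_approachable
  proof (intro allI impI)
    fix e :: real assume "e > 0"
    then obtain n where n: "(1/3::real) ^ n < e" using real_arch_pow_inv[of e "1/3"] by auto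
    have "x \<in> cantor_stage n" using x(2) by (auto simp: cantor_set_def)
    then obtain w where w: "set w \<subseteq> {I1, I3}" "\<And>\<alpha>. \<bar>ternary_value (w @- \<alpha>) - x\<bar> \<le> (1/3) ^ n"
      using cantor_stage_ternary_word by blast
    obtain k \<alpha> where "sdrop k dense_code = w @- \<alpha>" using dense_code_contains[OF w(1)] by blast
    \<comment> \<open>The code of the root has three digits before the part that contains all words.\<close>
    then have k: "sdrop (k + 3) root_code = w @- \<alpha>" by (simp add: root_code_def numeral_3_eq_3)
    have "dist (address_map hairy_map brush (sdrop (k + 3) root_code)) p < e"
      using w(2)[of \<alpha>] n by (simp add: address_shift k[symmetric] x(1) dist_Pair_Pair dist_real_def) 
    then show "\<exists>y\<in>address_map hairy_map brush ` post_critical_set hairy_map brush. dist y p < e"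
      using post_critical_shift[of "k + 3"] by auto
  qed
qed

lemma infinite_post_critical_set: "infinite (post_critical_set hairy_map brush)"
proof
  assume "finite (post_critical_set hairy_map brush)"
  then have "finite (closure (address_map hairy_map brush ` post_critical_set hairy_map brush))"
    by (simp add: finite_imp_closed)
  then have "finite (cantor_set \<times> {0::real})" using cantor_set_closure finite_subset by blast
  then show False using cantor_set_infinite by (simp add: finite_cartesian_product_iff)
qed

theorem theorem1:
  shows "\<exists>(S :: index \<Rightarrow> real \<times> real \<Rightarrow> real \<times> real) K.
    (\<forall>i. contraction_similarity (S i)) \<and>
    is_attractor S K \<and>
    dendrite K \<and>
    open_set_condition S \<and>
    one_point_intersection S K \<and>
    infinite (post_critical_set S K) \<and>
    cantor_set \<times> {0} \<subseteq> closure (address_map S K ` post_critical_set S K)"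
proof (intro exI conjI allI)
  show "contraction_similarity (hairy_map i)" for i by (rule contraction_similarity_hairy)
  show "is_attractor hairy_map brush" by (rule is_attractor_brush)
  show "dendrite brush"
    unfolding dendrite_def
  proof (intro conjI)
    show "brush \<noteq> {}" using segment_brush[of 0] by auto
  qed (rule compact_brush connected_brush locally_connected_brush no_simple_loop_brush)+
qed (rule open_set_condition_hairy one_point_intersection_brush infinite_post_critical_set cantor_set_closure)+

end
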